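(* Let $\tau\in\mathbb{R}_{\ge0}^{|E|T}$ and $B\in\mathbb{R}_{\ge0}^{|G^E|}$. Suppose each eligible group has time-invariant value of time, i.e. $v_t^g=v_{t'}^g$ for every $g\in G^E$ and $t,t'\in[T]$. Then a feasible flow $y^\star\in\mathcal{Y}^C(\tau,B)$ is a $(\tau,B)$-CBCP equilibrium if and only if it (together with its lane flows) is a minimizer of the convex program $$\min_{y\in\mathcal{Y}^C(\tau,B),\,x\in\mathbb{R}^{2|E|T}}\ \sum_{t\in[T]}\sum_{e\in E}\Big[\sum_{k=1}^2\int_0^{x_{e,k,t}}\ell_e(w)\,dw+\sum_{g\in G_e^I}\frac{y_{e,1,t}^g\tau_{e,t}}{v_t^g}\Big]$$ subject to $x_{e,k,t}=\sum_{g\in G_e}y_{e,k,t}^g$ for all $e\in E,k\in[2],t\in[T]$.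
   Context: Network. $(I,E)$ is a finite acyclic directed graph; $E_i^{\mathrm{in}},E_i^{\mathrm{out}}$ are the edges entering/leaving node $i$. Each edge has two lanes $k\in[2]=\{1,2\}$: an express lane ($k=1$, may be tolled) and a toll-free general-purpose lane ($k=2$). Both lanes of $e$ have the same latency function $\ell_e:\mathbb{R}\to\mathbb{R}$, strictly increasing, convex, nonnegative on $\mathbb{R}_{\ge0}$. Periods are $t\in[T]=\{1,\dots,T\}$. Users. $G=G^E\sqcup G^I$ is a finite set of groups, eligible ($G^E$) or ineligible ($G^I$). Group $g$ has an origin $p_o^g$ and destination $p_d^g$ joined by at least one directed route, a demand $d^g\ge0$, and values of time $v_t^g>0$, $t\in[T]$. $G_e$ is the set of groups having a route from $p_o^g$ to $p_d^g$ containing $e$; $G_e^E=G_e\cap G^E$, $G_e^I=G_e\cap G^I$; $n=\sum_{e}|G_e|$. Flows. A flow is $y=(y_{e,k,t}^g: e\in E,k\in[2],t\in[T],g\in G_e)\in\mathbb{R}_{\ge0}^{2nT}$; $\mathcal{Y}_{\mathrm{adm}}$ is the set of flows such that for all $i\in I,g\in G,t\in[T]$: $d^g\mathbf 1\{i=p_o^g\}+\sum_{e\in E_i^{\mathrm{in}}}\sum_{k}y_{e,k,t}^g=d^g\mathbf 1\{i=p_d^g\}+\sum_{e\in E_i^{\mathrm{out}}}\sum_{k}y_{e,k,t}^g$ (sums over edges with $g\in G_e$). Lane flows: $x_{e,k,t}=\sum_{g\in G_e}y_{e,k,t}^g$. CBCP (credit-based congestion pricing). A policy is $(\tau,B)$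 with tolls $\tau\in\mathbb{R}_{\ge0}^{|E|T}$ and budgets $B\in\mathbb{R}_{\ge0}^{|G^E|}$. The feasible set is $\mathcal{Y}^C(\tau,B)=\{y\in\mathcal{Y}_{\mathrm{adm}}:\sum_{t}\sum_{e}y_{e,1,t}^g\tau_{e,t}\le B^g\ \forall g\in G^E\}$. The cost $c_{e,k,t}^g(y)$ is $v_t^g\ell_e(x_{e,1,t})+\tau_{e,t}$ if $k=1,g\in G^I$, and $v_t^g\ell_e(x_{e,k,t})$ otherwise. A flow $y^\star\in\mathcal{Y}^C(\tau,B)$ is a $(\tau,B)$-CBCP equilibrium if for each $g\in G$ and every $y\in\mathcal{Y}^C(\tau,B)$: $\sum_{e,k,t}(y_{e,k,t}^g-y_{e,k,t}^{g\star})c_{e,k,t}^g(y^\star)\ge0$. *)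

theory Defs
  imports
    "HOL-Analysis.Interval_Integral"
    "HOL-Library.FuncSet"
    "Graph_Theory.Digraph"
    "Graph_Theory.Arc_Walk"
begin

section \<open>Networks with express lanes\<close>

record ('v, 'e, 'g) network =
  graph :: "('v, 'e) pre_digraph"
  latency :: "'e \<Rightarrow> real \<Rightarrow> real"
  horizon :: nat
  eligible :: "'g set"
  ineligible :: "'g set"
  origin :: "'g \<Rightarrow> 'v"
  destination :: "'g \<Rightarrow> 'v"
  demand :: "'g \<Rightarrow> real"
  vot :: "'g \<Rightarrow> nat \<Rightarrow> real"  \<comment> \<open>value of time of a group in a period\<close>

abbreviation edges :: "('v, 'e, 'g) network \<Rightarrow> 'e set" where
  "edges N \<equiv> arcs (graph N)"

abbreviation groups :: "('v, 'e, 'g) network \<Rightarrow> 'g set" where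
  "groups N \<equiv> eligible N \<union> ineligible N"

abbreviation periods :: "('v, 'e, 'g) network \<Rightarrow> nat set" where
  "periods N \<equiv> {1..horizon N}"

text \<open>Lane 1 is the express lane, lane 2 the general-purpose lane.\<close>

abbreviation lanes :: "nat set" where
  "lanes \<equiv> {1, 2}"

definition route :: "('v, 'e, 'g) network \<Rightarrow> 'g \<Rightarrow> 'e list \<Rightarrow> bool" where
  "route N g p \<longleftrightarrow> pre_digraph.awalk (graph N) (origin N g) p (destination N g)"

text \<open>
  Parallel edges are allowed. In an acyclic graph every directed walk is a path, so routes need no
  separate distinctness condition.
\<close>

locale cbcp_network = fin_digraph "graph N" for N :: "('v, 'e, 'g) network" +
  assumes acyclic_graph: "acyclic (arcs_ends (graph N))"
    and latency_strict_mono: "\<And>e. e \<in> edges N \<Longrightarrow> strict_mono (latency N e)"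
    and latency_convex: "\<And>e. e \<in> edges N \<Longrightarrow> convex_on UNIV (latency N e)"
    and latency_nonneg: "\<And>e x. e \<in> edges N \<Longrightarrow> 0 \<le> x \<Longrightarrow> 0 \<le> latency N e x"
    and finite_groups: "finite (groups N)"
    and groups_disjoint: "eligible N \<inter> ineligible N = {}"
    and route_exists: "\<And>g. g \<in> groups N \<Longrightarrow> \<exists>p. route N g p"
    and demand_nonneg: "\<And>g. g \<in> groups N \<Longrightarrow> 0 \<le> demand N g"
    and vot_pos: "\<And>g t. g \<in> groups N \<Longrightarrow> t \<in> periods N \<Longrightarrow> 0 < vot N g t"

definition groups_at :: "('v, 'e, 'g) network \<Rightarrow> 'e \<Rightarrow> 'g set" where
  "groups_at N e = {g \<in> groups N. \<exists>p. route N g p \<and> e \<in> set p}"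

definition edges_of :: "('v, 'e, 'g) network \<Rightarrow> 'g \<Rightarrow> 'e set" where
  "edges_of N g = {e \<in> edges N. g \<in> groups_at N e}"

section \<open>Flows\<close>

text \<open>
  Vectors indexed by a finite set are represented by extensional functions on that set, so that
  \<open>flows N\<close> is exactly the nonnegative orthant over the indices \<open>(e, k, t, g)\<close> with \<open>g\<close> having a
  route through \<open>e\<close>.
\<close>

type_synonym ('e, 'g) flow = "'e \<times> nat \<times> nat \<times> 'g \<Rightarrow> real"
type_synonym 'e lane_flow = "'e \<times> nat \<times> nat \<Rightarrow> real"

definition flow_index :: "('v, 'e, 'g) network \<Rightarrow> ('e \<times> nat \<times> nat \<times> 'g) set" where
  "flow_index N =
     {(e, k, t, g). e \<in> edges N \<and> k \<in> lanes \<and> t \<in> periods N \<and> g \<in> groups_at N e}"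

definition flows :: "('v, 'e, 'g) network \<Rightarrow> ('e, 'g) flow set" where
  "flows N = flow_index N \<rightarrow>\<^sub>E {0..}"

definition admissible_flows :: "('v, 'e, 'g) network \<Rightarrow> ('e, 'g) flow set" where
  "admissible_flows N = {y \<in> flows N.
     \<forall>i \<in> verts (graph N). \<forall>g \<in> groups N. \<forall>t \<in> periods N.
       demand N g * of_bool (i = origin N g)
         + (\<Sum>e \<in> in_arcs (graph N) i \<inter> edges_of N g. \<Sum>k \<in> lanes. y (e, k, t, g))
     = demand N g * of_bool (i = destination N g)
         + (\<Sum>e \<in> out_arcs (graph N) i \<inter> edges_of N g. \<Sum>k \<in> lanes. y (e, k, t, g))}"

definition lane_flow :: "('v, 'e, 'g) network \<Rightarrow> ('e, 'g) flow \<Rightarrow> 'e lane_flow" where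
  "lane_flow N y =
     (\<lambda>(e, k, t) \<in> edges N \<times> lanes \<times> periods N. \<Sum>g \<in> groups_at N e. y (e, k, t, g))"

section \<open>Credit-based congestion pricing\<close>

definition cbcp_flows ::
    "('v, 'e, 'g) network \<Rightarrow> ('e \<times> nat \<Rightarrow> real) \<Rightarrow> ('g \<Rightarrow> real) \<Rightarrow> ('e, 'g) flow set" where
  "cbcp_flows N \<tau> B = {y \<in> admissible_flows N.
     \<forall>g \<in> eligible N.
       (\<Sum>t \<in> periods N. \<Sum>e \<in> edges_of N g. y (e, 1, t, g) * \<tau> (e, t)) \<le> B g}"

definition cost ::
    "('v, 'e, 'g) network \<Rightarrow> ('e \<times> nat \<Rightarrow> real) \<Rightarrow> ('e, 'g) flow
     \<Rightarrow> 'e \<Rightarrow> nat \<Rightarrow> nat \<Rightarrow> 'g \<Rightarrow> real" where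
  "cost N \<tau> y e k t g =
     (if k = 1 \<and> g \<in> ineligible N
      then vot N g t * latency N e (lane_flow N y (e, 1, t)) + \<tau> (e, t)
      else vot N g t * latency N e (lane_flow N y (e, k, t)))"

definition cbcp_equilibrium ::
    "('v, 'e, 'g) network \<Rightarrow> ('e \<times> nat \<Rightarrow> real) \<Rightarrow> ('g \<Rightarrow> real) \<Rightarrow> ('e, 'g) flow \<Rightarrow> bool" where
  "cbcp_equilibrium N \<tau> B y' \<longleftrightarrow> y' \<in> cbcp_flows N \<tau> B \<and>
     (\<forall>g \<in> groups N. \<forall>y \<in> cbcp_flows N \<tau> B.
        (\<Sum>e \<in> edges_of N g. \<Sum>k \<in> lanes. \<Sum>t \<in> periods N.
           (y (e, k, t, g) - y' (e, k, t, g)) * cost N \<tau> y' e k t g) \<ge> 0)"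

section \<open>The convex program\<close>

definition program_feasible ::
    "('v, 'e, 'g) network \<Rightarrow> ('e \<times> nat \<Rightarrow> real) \<Rightarrow> ('g \<Rightarrow> real)
     \<Rightarrow> (('e, 'g) flow \<times> 'e lane_flow) set" where
  "program_feasible N \<tau> B =
     {(y, x). y \<in> cbcp_flows N \<tau> B \<and> x \<in> edges N \<times> lanes \<times> periods N \<rightarrow>\<^sub>E UNIV \<and>
        (\<forall>e \<in> edges N. \<forall>k \<in> lanes. \<forall>t \<in> periods N.
           x (e, k, t) = (\<Sum>g \<in> groups_at N e. y (e, k, t, g)))}"

definition program_objective ::
    "('v, 'e, 'g) network \<Rightarrow> ('e \<times> nat \<Rightarrow> real) \<Rightarrow> ('e, 'g) flow \<times> 'e lane_flow \<Rightarrow> real" where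
  "program_objective N \<tau> = (\<lambda>(y, x).
     \<Sum>t \<in> periods N. \<Sum>e \<in> edges N.
       (\<Sum>k \<in> lanes. LBINT w = 0..ereal (x (e, k, t)). latency N e w)
       + (\<Sum>g \<in> groups_at N e \<inter> ineligible N. y (e, 1, t, g) * \<tau> (e, t) / vot N g t))"

end

theory Submission
  imports Defs "HOL-Analysis.Convex_Euclidean_Space"
begin

text \<open>
  Dividing the equilibrium condition of a group by its value of time turns it into the first-order
  optimality condition of the convex program. For an eligible group the value of time is a constant
  factor. An ineligible group has no budget coupling its periods, so its condition splits into one
  condition per period, each of which may be divided by its own value of time. Conditions for
  separate groups (and periods) add up to a single variational inequality, since the feasible set
  is closed under replacing a flow by another one on a single group. The variational inequality is
  equivalent to minimality because the latencies are increasing and continuous.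
\<close>

section \<open>Tangent inequality for the primitive of an increasing function\<close>

lemma LBINT_above_tangent:
  fixes f :: "real \<Rightarrow> real"
  assumes "mono f" and cont: "continuous_on UNIV f"
  shows "f a * (b - a) \<le> (LBINT w=0..ereal b. f w) - (LBINT w=0..ereal a. f w)"
proof -
  define F where "F = (\<lambda>u::real. LBINT w=0..ereal u. f w)"
  have F: "(F has_real_derivative f x) (at x)" for x
  proof -
    \<comment> \<open>The interval has to contain the base point 0 and to have \<open>x\<close> in
      its interior, so that the derivative within the interval is the full derivative at
      \<open>x\<close>.\<close>
    define M where "M = \<bar>x\<bar> + 1"
    have "((\<lambda>u. LBINT w=ereal 0..ereal u. f w) has_vector_derivative f x) (at x within {-M..M})"
      by (rule interval_integral_FTC2)
         (auto simp: M_def intro: continuous_on_subset[OF cont])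
    moreover have "x \<in> interior {-M..M}"
      by (auto simp: M_def)
    ultimately show ?thesis
      unfolding F_def zero_ereal_def has_real_derivative_iff_has_vector_derivative
      by (simp only: at_within_interior)
  qed
  \<comment> \<open>The mean value theorem gives an intermediate \<open>z\<close>. Monotonicity
    compares \<open>f z\<close> with \<open>f a\<close>, and the order of \<open>a\<close> and
    \<open>b\<close> decides the direction.\<close>
  consider "a = b" | "a < b" | "b < a" by linarith
  then have "f a * (b - a) \<le> F b - F a"
  proof cases
    case 2
    then obtain z where z: "a < z" "F b - F a = (b - a) * f z"
      using MVT2[of a b F f] F by blast
    have "f a * (b - a) \<le> f z * (b - a)"
      using monoD[OF \<open>mono f\<close>, of a z] z(1) 2 by (intro mult_right_mono) auto
    then show ?thesis using z(2) by (simp add: mult.commute)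
  next
    case 3
    then obtain z where z: "z < a" "F a - F b = (a - b) * f z"
      using MVT2[of b a F f] F by blast
    have "f z * (a - b) \<le> f a * (a - b)"
      using monoD[OF \<open>mono f\<close>, of z a] z(1) 3 by (intro mult_right_mono) auto
    then show ?thesis using z(2) by (simp add: algebra_simps)
  qed simp
  then show ?thesis by (simp add: F_def)
qed

section \<open>Gaps, spliced and blended flows, and slopes\<close>

text \<open>The share of one period in the equilibrium sum of a group, isolated so that it can be
  divided by the value of time of that period.\<close>

definition period_gap ::
    "('v, 'e, 'g) network \<Rightarrow> ('e \<times> nat \<Rightarrow> real) \<Rightarrow> ('e, 'g) flow \<Rightarrow> ('e, 'g) flow
     \<Rightarrow> nat \<Rightarrow> 'g \<Rightarrow> real" where
  "period_gap N \<tau> y' y t g = (\<Sum>e \<in> edges_of N g. \<Sum>k \<in> lanes.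
     (y (e, k, t, g) - y' (e, k, t, g)) * cost N \<tau> y' e k t g)"

definition splice_flow ::
    "(nat \<Rightarrow> 'g \<Rightarrow> bool) \<Rightarrow> ('e, 'g) flow \<Rightarrow> ('e, 'g) flow \<Rightarrow> ('e, 'g) flow" where
  "splice_flow P y z = (\<lambda>(e, k, t, g). if P t g then y (e, k, t, g) else z (e, k, t, g))"

definition blend_flow ::
    "('v, 'e, 'g) network \<Rightarrow> real \<Rightarrow> ('e, 'g) flow \<Rightarrow> ('e, 'g) flow \<Rightarrow> ('e, 'g) flow" where
  "blend_flow N s y z = (\<lambda>i \<in> flow_index N. (1 - s) * y i + s * z i)"

text \<open>For \<open>x = lane_flow N y'\<close> this is the directional derivative of the
  objective at \<open>y'\<close> towards \<open>y\<close>. Keeping \<open>x\<close> free allows the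
  same direction to be tested with latencies taken at another flow.\<close>

definition program_slope ::
    "('v, 'e, 'g) network \<Rightarrow> ('e \<times> nat \<Rightarrow> real) \<Rightarrow> 'e lane_flow
     \<Rightarrow> ('e, 'g) flow \<Rightarrow> ('e, 'g) flow \<Rightarrow> real" where
  "program_slope N \<tau> x y' y = (\<Sum>t \<in> periods N. \<Sum>e \<in> edges N.
     (\<Sum>k \<in> lanes. latency N e (x (e, k, t)) *
        (lane_flow N y (e, k, t) - lane_flow N y' (e, k, t)))
     + (\<Sum>g \<in> groups_at N e \<inter> ineligible N.
          (y (e, 1, t, g) - y' (e, 1, t, g)) * \<tau> (e, t) / vot N g t))"

section \<open>Closure of the feasible set under splicing and blending\<close>

lemma period_gap_splice_flow:
  "period_gap N \<tau> z (splice_flow P y z) t g = (if P t g then period_gap N \<tau> z y t g else 0)"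
  by (simp add: period_gap_def splice_flow_def)

text \<open>Flow conservation is a separate equation for each group and period, so it survives any
  choice of \<open>P\<close>. A budget couples all periods of an eligible group, so there the choice
  may depend on the group only, which is the role of \<open>Q\<close>.\<close>

lemma splice_flow_in_cbcp_flows:
  assumes y: "y \<in> cbcp_flows N \<tau> B" and z: "z \<in> cbcp_flows N \<tau> B"
    and P: "\<And>g t. g \<in> eligible N \<Longrightarrow> P t g \<longleftrightarrow> Q g"
  shows "splice_flow P y z \<in> cbcp_flows N \<tau> B"
proof -
  have "splice_flow P y z \<in> flows N"
    using y z by (fastforce simp: cbcp_flows_def admissible_flows_def flows_def splice_flow_def PiE_iff
        extensional_def)
  moreover have "demand N g * of_bool (i = origin N g)
         + (\<Sum>e \<in> in_arcs (graph N) i \<inter> edges_of N g. \<Sum>k \<in> lanes. splice_flow P y z (e, k, t, g))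
     = demand N g * of_bool (i = destination N g)
         + (\<Sum>e \<in> out_arcs (graph N) i \<inter> edges_of N g. \<Sum>k \<in> lanes. splice_flow P y z (e, k, t, g))"
    if "i \<in> verts (graph N)" "g \<in> groups N" "t \<in> periods N" for i g t
  proof (cases "P t g")
    case True
    then show ?thesis
      using y that unfolding cbcp_flows_def admissible_flows_def splice_flow_def prod.case if_P[OF True]
      by blast
  next
    case False
    then show ?thesis
      using z that unfolding cbcp_flows_def admissible_flows_def splice_flow_def prod.case if_not_P[OF False]
      by blast
  qed
  ultimately have "splice_flow P y z \<in> admissible_flows N"
    unfolding admissible_flows_def by blast
  moreover have "(\<Sum>t \<in> periods N. \<Sum>e \<in> edges_of N g. splice_flow P y z (e, 1, t, g) * \<tau> (e, t)) \<le> B g"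
    if "g \<in> eligible N" for g
    using y z that P[OF that] by (cases "Q g") (auto simp: cbcp_flows_def splice_flow_def)
  ultimately show ?thesis by (simp add: cbcp_flows_def)
qed

text \<open>Conservation and budgets are affine in the flow, so the feasible set is convex.\<close>

lemma blend_flow_in_cbcp_flows:
  fixes N :: "('v, 'e, 'g) network" and y z :: "('e, 'g) flow"
  assumes y: "y \<in> cbcp_flows N \<tau> B" and z: "z \<in> cbcp_flows N \<tau> B"
    and s: "0 \<le> s" "s \<le> 1"
  shows "blend_flow N s y z \<in> cbcp_flows N \<tau> B"
proof -
  have idx: "(e, k, t, g) \<in> flow_index N"
    if "e \<in> edges_of N g" "k \<in> lanes" "t \<in> periods N" for e k t g
    using that by (auto simp: flow_index_def edges_of_def)
  have lin: "(\<Sum>e\<in>E. \<Sum>k\<in>lanes. blend_flow N s y z (e, k, t, g))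
      = (1 - s) * (\<Sum>e\<in>E. \<Sum>k\<in>lanes. y (e, k, t, g))
        + s * (\<Sum>e\<in>E. \<Sum>k\<in>lanes. z (e, k, t, g))"
    if "E \<subseteq> edges_of N g" "t \<in> periods N" for E t g
  proof -
    have "(\<Sum>e\<in>E. \<Sum>k\<in>lanes. blend_flow N s y z (e, k, t, g))
        = (\<Sum>e\<in>E. \<Sum>k\<in>lanes. (1 - s) * y (e, k, t, g) + s * z (e, k, t, g))"
      using that idx by (intro sum.cong refl) (auto simp: blend_flow_def)
    then show ?thesis by (simp only: sum.distrib sum_distrib_left)
  qed
  have "blend_flow N s y z \<in> flows N"
    using y z s by (auto simp: cbcp_flows_def admissible_flows_def flows_def blend_flow_def PiE_iff)
  moreover have "demand N g * of_bool (i = origin N g)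
         + (\<Sum>e \<in> in_arcs (graph N) i \<inter> edges_of N g. \<Sum>k \<in> lanes. blend_flow N s y z (e, k, t, g))
     = demand N g * of_bool (i = destination N g)
         + (\<Sum>e \<in> out_arcs (graph N) i \<inter> edges_of N g. \<Sum>k \<in> lanes. blend_flow N s y z (e, k, t, g))"
    if i: "i \<in> verts (graph N)" and g: "g \<in> groups N" and t: "t \<in> periods N" for i g t
  proof -
    define a where "a = demand N g * of_bool (i = origin N g)"
    define b where "b = demand N g * of_bool (i = destination N g)"
    define I where "I u = (\<Sum>e \<in> in_arcs (graph N) i \<inter> edges_of N g. \<Sum>k \<in> lanes. u (e, k, t, g))"
      for u :: "('e, 'g) flow"
    define O' where "O' u = (\<Sum>e \<in> out_arcs (graph N) i \<inter> edges_of N g. \<Sum>k \<in> lanes. u (e, k, t, g))"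
      for u :: "('e, 'g) flow"
    have eq: "a + I y = b + O' y" "a + I z = b + O' z"
      using y z i g t
      unfolding cbcp_flows_def admissible_flows_def a_def b_def I_def O'_def by blast+
    have bl: "I (blend_flow N s y z) = (1 - s) * I y + s * I z"
      "O' (blend_flow N s y z) = (1 - s) * O' y + s * O' z"
      unfolding I_def O'_def using t by (intro lin; blast)+
    have "a + I (blend_flow N s y z) = (1 - s) * (a + I y) + s * (a + I z)"
      by (simp add: bl algebra_simps)
    also have "\<dots> = b + O' (blend_flow N s y z)"
      by (simp add: eq bl algebra_simps)
    finally show ?thesis by (simp only: a_def b_def I_def O'_def)
  qed
  ultimately have "blend_flow N s y z \<in> admissible_flows N"
    unfolding admissible_flows_def by blast
  moreover have "(\<Sum>t \<in> periods N. \<Sum>e \<in> edges_of N g. blend_flow N s y z (e, 1, t, g) * \<tau> (e, t)) \<le> B g"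
    if g: "g \<in> eligible N" for g
  proof -
    define T where "T u = (\<Sum>t \<in> periods N. \<Sum>e \<in> edges_of N g. u (e, 1, t, g) * \<tau> (e, t))"
      for u :: "('e, 'g) flow"
    have "T (blend_flow N s y z) = (\<Sum>t \<in> periods N. \<Sum>e \<in> edges_of N g.
        (1 - s) * (y (e, 1, t, g) * \<tau> (e, t)) + s * (z (e, 1, t, g) * \<tau> (e, t)))"
      unfolding T_def using idx by (intro sum.cong refl) (auto simp: blend_flow_def algebra_simps)
    also have "\<dots> = (1 - s) * T y + s * T z"
      by (simp only: T_def sum.distrib sum_distrib_left)
    also have "\<dots> \<le> (1 - s) * B g + s * B g"
      using y z g s unfolding T_def cbcp_flows_def
      by (intro add_mono mult_left_mono) auto
    finally show ?thesis by (simp add: T_def algebra_simps)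
  qed
  ultimately show ?thesis by (simp add: cbcp_flows_def)
qed

lemma lane_flow_blend_flow:
  assumes "e \<in> edges N" "k \<in> lanes" "t \<in> periods N"
  shows "lane_flow N (blend_flow N s y z) (e, k, t)
    = (1 - s) * lane_flow N y (e, k, t) + s * lane_flow N z (e, k, t)"
proof -
  have "(\<Sum>g\<in>groups_at N e. blend_flow N s y z (e, k, t, g))
      = (\<Sum>g\<in>groups_at N e. (1 - s) * y (e, k, t, g) + s * z (e, k, t, g))"
    using assms by (intro sum.cong refl) (auto simp: blend_flow_def flow_index_def)
  then show ?thesis
    using assms by (simp add: lane_flow_def sum.distrib sum_distrib_left)
qed

lemma program_slope_blend_flow:
  "program_slope N \<tau> x y (blend_flow N s y z) = s * program_slope N \<tau> x y z"
proof -
  have "lane_flow N (blend_flow N s y z) (e, k, t) - lane_flow N y (e, k, t)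
      = s * (lane_flow N z (e, k, t) - lane_flow N y (e, k, t))"
    if "e \<in> edges N" "k \<in> lanes" "t \<in> periods N" for e k t
    using lane_flow_blend_flow[OF that] by (simp add: algebra_simps)
  moreover have "(blend_flow N s y z (e, 1, t, g) - y (e, 1, t, g)) * \<tau> (e, t) / vot N g t
      = s * ((z (e, 1, t, g) - y (e, 1, t, g)) * \<tau> (e, t) / vot N g t)"
    if "e \<in> edges N" "t \<in> periods N" "g \<in> groups_at N e" for e t g
  proof -
    have "(e, 1, t, g) \<in> flow_index N" using that by (simp add: flow_index_def)
    then have "blend_flow N s y z (e, 1, t, g) - y (e, 1, t, g) = s * (z (e, 1, t, g) - y (e, 1, t, g))"
      by (simp add: blend_flow_def algebra_simps)
    then show ?thesis by simp
  qed
  ultimately show ?thesis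
    unfolding program_slope_def sum_distrib_left distrib_left
    by (intro sum.cong refl arg_cong2[of _ _ _ _ "(+)"]) (simp_all add: mult_ac)
qed

section \<open>Elimination of the lane-flow variable\<close>

text \<open>Because \<open>x\<close> is extensional, the coupling equations on the index set fix it
  everywhere, and the program becomes a minimization over \<open>y\<close> alone.\<close>

lemma program_feasible_iff:
  "(y, x) \<in> program_feasible N \<tau> B \<longleftrightarrow> y \<in> cbcp_flows N \<tau> B \<and> x = lane_flow N y"
proof -
  have "x \<in> edges N \<times> lanes \<times> periods N \<rightarrow>\<^sub>E UNIV \<and>
      (\<forall>e \<in> edges N. \<forall>k \<in> lanes. \<forall>t \<in> periods N. x (e, k, t) = (\<Sum>g \<in> groups_at N e. y (e, k, t, g)))
    \<longleftrightarrow> x = lane_flow N y" (is "?L \<longleftrightarrow> _")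
  proof
    assume L: ?L
    show "x = lane_flow N y"
    proof
      fix i
      show "x i = lane_flow N y i"
        using L by (cases i; cases "i \<in> edges N \<times> lanes \<times> periods N")
          (auto simp: lane_flow_def PiE_iff extensional_def)
    qed
  qed (auto simp: lane_flow_def PiE_iff extensional_def)
  then show ?thesis by (auto simp: program_feasible_def)
qed

lemma is_arg_min_program_iff:
  assumes "y' \<in> cbcp_flows N \<tau> B"
  shows "is_arg_min (program_objective N \<tau>) (\<lambda>z. z \<in> program_feasible N \<tau> B) (y', lane_flow N y')
    \<longleftrightarrow> (\<forall>y \<in> cbcp_flows N \<tau> B.
          program_objective N \<tau> (y', lane_flow N y') \<le> program_objective N \<tau> (y, lane_flow N y))"
  using assms by (auto simp: is_arg_min_linorder program_feasible_iff)

section \<open>Slope and minimality\<close>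

context cbcp_network
begin

lemma finite_groups_at: "finite (groups_at N e)"
  using finite_groups by (simp add: groups_at_def)

lemma continuous_on_latency:
  assumes "e \<in> edges N"
  shows "continuous_on UNIV (latency N e)"
  using latency_convex[OF assms] by (rule convex_on_continuous[OF open_UNIV])

text \<open>The tangent inequality is applied on each edge, lane and period and summed; the toll
  term is linear in the flow and contributes equally to both sides.\<close>

lemma program_slope_le_objective_diff:
  "program_slope N \<tau> (lane_flow N y') y' y
     \<le> program_objective N \<tau> (y, lane_flow N y) - program_objective N \<tau> (y', lane_flow N y')"
proof -
  have "latency N e a * (b - a)
      \<le> (LBINT w=0..ereal b. latency N e w) - (LBINT w=0..ereal a. latency N e w)"
    if "e \<in> edges N" for e a b
    using latency_strict_mono[OF that] continuous_on_latency[OF that]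
    by (intro LBINT_above_tangent strict_mono_mono)
  then show ?thesis
    unfolding program_slope_def program_objective_def split_def fst_conv snd_conv
      sum_subtractf[symmetric]
    by (intro sum_mono)
       (force simp: add_diff_add sum_subtractf[symmetric] left_diff_distrib diff_divide_distrib
         intro!: add_mono sum_mono)
qed

text \<open>All users of a lane see the same latency. Dividing a group's cost by its value of time
  therefore leaves this common latency, plus the scaled toll for ineligible groups on lane 1, and
  the change in lane flow splits into the changes of the groups.\<close>

lemma program_slope_eq_sum_period_gap:
  "program_slope N \<tau> (lane_flow N y') y' y
     = (\<Sum>t \<in> periods N. \<Sum>g \<in> groups N. period_gap N \<tau> y' y t g / vot N g t)"
  unfolding program_slope_def
proof (rule sum.cong[OF refl])
  fix t assume t: "t \<in> periods N"
  define c where "c e g = (\<Sum>k \<in> lanes. (y (e, k, t, g) - y' (e, k, t, g))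
      * cost N \<tau> y' e k t g / vot N g t)" for e g
  have "(\<Sum>k \<in> lanes. latency N e (lane_flow N y' (e, k, t)) *
        (lane_flow N y (e, k, t) - lane_flow N y' (e, k, t)))
     + (\<Sum>g \<in> groups_at N e \<inter> ineligible N.
          (y (e, 1, t, g) - y' (e, 1, t, g)) * \<tau> (e, t) / vot N g t)
     = (\<Sum>g \<in> groups_at N e. c e g)" if e: "e \<in> edges N" for e
  proof -
    have "(\<Sum>k \<in> lanes. latency N e (lane_flow N y' (e, k, t)) *
        (lane_flow N y (e, k, t) - lane_flow N y' (e, k, t)))
      = (\<Sum>g \<in> groups_at N e. \<Sum>k \<in> lanes. latency N e (lane_flow N y' (e, k, t)) *
          (y (e, k, t, g) - y' (e, k, t, g)))"
      using e t by (subst sum.swap) (auto simp: lane_flow_def sum_distrib_left sum_subtractf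
          right_diff_distrib)
    moreover have "(\<Sum>g \<in> groups_at N e \<inter> ineligible N.
          (y (e, 1, t, g) - y' (e, 1, t, g)) * \<tau> (e, t) / vot N g t)
      = (\<Sum>g \<in> groups_at N e. if g \<in> ineligible N then
          (y (e, 1, t, g) - y' (e, 1, t, g)) * \<tau> (e, t) / vot N g t else 0)"
      by (rule sum.inter_restrict[OF finite_groups_at])
    moreover have "(\<Sum>k \<in> lanes. latency N e (lane_flow N y' (e, k, t)) *
          (y (e, k, t, g) - y' (e, k, t, g)))
        + (if g \<in> ineligible N then
            (y (e, 1, t, g) - y' (e, 1, t, g)) * \<tau> (e, t) / vot N g t else 0) = c e g"
      if "g \<in> groups_at N e" for g
    proof -
      have "vot N g t \<noteq> 0"
        using vot_pos[of g t] that t by (auto simp: groups_at_def)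
      then show ?thesis by (simp add: c_def cost_def field_simps)
    qed
    ultimately show ?thesis by (simp add: sum.distrib[symmetric])
  qed
  then have "(\<Sum>e \<in> edges N. (\<Sum>k \<in> lanes. latency N e (lane_flow N y' (e, k, t)) *
        (lane_flow N y (e, k, t) - lane_flow N y' (e, k, t)))
     + (\<Sum>g \<in> groups_at N e \<inter> ineligible N.
          (y (e, 1, t, g) - y' (e, 1, t, g)) * \<tau> (e, t) / vot N g t))
     = (\<Sum>e \<in> edges N. \<Sum>g \<in> groups_at N e. c e g)"
    by (intro sum.cong refl)
  \<comment> \<open>Written as a restriction of \<open>groups N\<close>, the inner index set shows
    the incidence relation between edges and groups along which the two sums are exchanged.\<close>
  also have "\<dots> = (\<Sum>e \<in> edges N. \<Sum>g | g \<in> groups N \<and> g \<in> groups_at N e. c e g)"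
    by (intro sum.cong refl) (auto simp: groups_at_def)
  also have "\<dots> = (\<Sum>g \<in> groups N. \<Sum>e \<in> edges_of N g. c e g)"
    unfolding edges_of_def by (rule sum.swap_restrict) (use finite_groups in auto)
  finally show "(\<Sum>e \<in> edges N. (\<Sum>k \<in> lanes. latency N e (lane_flow N y' (e, k, t)) *
        (lane_flow N y (e, k, t) - lane_flow N y' (e, k, t)))
     + (\<Sum>g \<in> groups_at N e \<inter> ineligible N.
          (y (e, 1, t, g) - y' (e, 1, t, g)) * \<tau> (e, t) / vot N g t))
     = (\<Sum>g \<in> groups N. period_gap N \<tau> y' y t g / vot N g t)"
    by (simp only: c_def period_gap_def sum_divide_distrib)
qed

text \<open>Sufficiency is the tangent inequality at \<open>y'\<close>. For necessity, slopes with
  latencies taken on the segment from \<open>y'\<close> to \<open>y\<close> are nonnegative, and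
  continuity of the latencies carries this to the endpoint.\<close>

lemma program_slope_nonneg_iff_minimal:
  assumes y': "y' \<in> cbcp_flows N \<tau> B"
  shows "(\<forall>y \<in> cbcp_flows N \<tau> B. 0 \<le> program_slope N \<tau> (lane_flow N y') y' y)
    \<longleftrightarrow> (\<forall>y \<in> cbcp_flows N \<tau> B.
          program_objective N \<tau> (y', lane_flow N y') \<le> program_objective N \<tau> (y, lane_flow N y))"
    (is "?slope \<longleftrightarrow> ?min")
proof
  assume slope: ?slope
  show ?min
  proof
    fix y assume "y \<in> cbcp_flows N \<tau> B"
    then have "0 \<le> program_slope N \<tau> (lane_flow N y') y' y" using slope by blast
    also note program_slope_le_objective_diff
    finally show "program_objective N \<tau> (y', lane_flow N y')
        \<le> program_objective N \<tau> (y, lane_flow N y)" by simp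
  qed
next
  assume min: ?min
  show ?slope
  proof
    fix y assume y: "y \<in> cbcp_flows N \<tau> B"
    define b where "b s = blend_flow N s y' y" for s
    text \<open>
      The tangent inequality at the blended flow, read towards \<open>y'\<close>, bounds the increase of the
      objective by the slope at the blended flow; no derivative of the objective is needed.
    \<close>
    have pos: "0 \<le> program_slope N \<tau> (lane_flow N (b s)) y' y" if s: "0 < s" "s < 1" for s
    proof -
      have "b s \<in> cbcp_flows N \<tau> B"
        using blend_flow_in_cbcp_flows[OF y' y] s by (simp add: b_def)
      then have "program_objective N \<tau> (y', lane_flow N y')
          \<le> program_objective N \<tau> (b s, lane_flow N (b s))"
        using min by blast
      then have "program_slope N \<tau> (lane_flow N (b s)) (b s) y' \<le> 0"
        using program_slope_le_objective_diff[of \<tau> "b s" y'] by linarith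
      \<comment> \<open>With \<open>x\<close> fixed the slope is antisymmetric in the two flows. The
        direction from \<open>y'\<close> to \<open>b s\<close> is \<open>s\<close> times that to
        \<open>y\<close>, and the factor cancels since \<open>s\<close> is positive.\<close>
      moreover have "program_slope N \<tau> (lane_flow N (b s)) (b s) y'
          = - program_slope N \<tau> (lane_flow N (b s)) y' (b s)"
        unfolding program_slope_def sum_negf[symmetric] minus_add_distrib
        by (intro sum.cong refl arg_cong2[of _ _ _ _ "(+)"])
           (simp_all add: algebra_simps diff_divide_distrib)
      ultimately show ?thesis
        using s by (simp add: b_def program_slope_blend_flow zero_le_mult_iff)
    qed
    \<comment> \<open>Only the latency coefficients vary with \<open>s\<close>; the direction from
      \<open>y'\<close> to \<open>y\<close> stays fixed.\<close>
    have "((\<lambda>s. program_slope N \<tau> (lane_flow N (b s)) y' y)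
        \<longlongrightarrow> program_slope N \<tau> (lane_flow N y') y' y) (at_right 0)"
      unfolding program_slope_def
    proof (intro tendsto_sum tendsto_add tendsto_const tendsto_mult)
      fix t e k assume i: "t \<in> periods N" "e \<in> edges N" "k \<in> lanes"
      have "((\<lambda>s. (1 - s) * lane_flow N y' (e, k, t) + s * lane_flow N y (e, k, t))
          \<longlongrightarrow> (1 - 0) * lane_flow N y' (e, k, t) + 0 * lane_flow N y (e, k, t)) (at_right 0)"
        by (intro tendsto_intros)
      then have "((\<lambda>s. lane_flow N (b s) (e, k, t)) \<longlongrightarrow> lane_flow N y' (e, k, t)) (at_right 0)"
        unfolding b_def using i by (subst lane_flow_blend_flow) auto
      moreover have "isCont (latency N e) (lane_flow N y' (e, k, t))"
        using continuous_on_latency[OF i(2)] by (simp add: continuous_on_eq_continuous_at)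
      ultimately show "((\<lambda>s. latency N e (lane_flow N (b s) (e, k, t)))
          \<longlongrightarrow> latency N e (lane_flow N y' (e, k, t))) (at_right 0)"
        by (rule isCont_tendsto_compose[rotated])
    qed
    moreover have "eventually (\<lambda>s. 0 \<le> program_slope N \<tau> (lane_flow N (b s)) y' y) (at_right 0)"
      using eventually_at_right_less[of 0] eventually_at_right_field[of _ "0::real"] pos
      by (auto intro!: exI[of _ 1])
    ultimately show "0 \<le> program_slope N \<tau> (lane_flow N y') y' y"
      by (rule tendsto_lowerbound) simp
  qed
qed

section \<open>Equilibrium as a single variational inequality\<close>

lemma cbcp_equilibrium_iff_program_slope_nonneg:
  assumes vot: "\<And>g t t'. g \<in> eligible N \<Longrightarrow> t \<in> periods N \<Longrightarrow> t' \<in> periods N \<Longrightarrow>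
           vot N g t = vot N g t'"
    and y': "y' \<in> cbcp_flows N \<tau> B"
  shows "cbcp_equilibrium N \<tau> B y'
    \<longleftrightarrow> (\<forall>y \<in> cbcp_flows N \<tau> B. 0 \<le> program_slope N \<tau> (lane_flow N y') y' y)"
proof -
  let ?h = "period_gap N \<tau> y'"
  have eq: "cbcp_equilibrium N \<tau> B y' \<longleftrightarrow>
      (\<forall>g \<in> groups N. \<forall>y \<in> cbcp_flows N \<tau> B. 0 \<le> (\<Sum>t \<in> periods N. ?h y t g))"
    unfolding cbcp_equilibrium_def period_gap_def
    using y' by (simp only: sum.swap[of _ "periods N"] simp_thms)
  \<comment> \<open>Period 1 serves as reference: it belongs to the horizon as soon as any period
    does.\<close>
  have elig: "(\<Sum>t \<in> periods N. ?h y t g / vot N g t) = (\<Sum>t \<in> periods N. ?h y t g) / vot N g 1"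
    if "g \<in> eligible N" for y g
    unfolding sum_divide_distrib
  proof (intro sum.cong refl)
    fix t assume "t \<in> periods N"
    then show "?h y t g / vot N g t = ?h y t g / vot N g 1"
      using vot[OF that, of t 1] by simp
  qed
  show ?thesis
  proof
    assume L: "cbcp_equilibrium N \<tau> B y'"
    show "\<forall>y \<in> cbcp_flows N \<tau> B. 0 \<le> program_slope N \<tau> (lane_flow N y') y' y"
    proof
      fix y assume y: "y \<in> cbcp_flows N \<tau> B"
      have "0 \<le> (\<Sum>t \<in> periods N. ?h y t g / vot N g t)" if g: "g \<in> groups N" for g
      proof (cases "g \<in> eligible N")
        case True
        show ?thesis
        \<comment> \<open>With an empty horizon nothing is known about the sign of
          \<open>vot N g 1\<close>, but the sums are empty.\<close>
        proof (cases "periods N = {}")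
          case False
          then have "0 < vot N g 1" using vot_pos[OF g, of 1] by simp
          moreover have "0 \<le> (\<Sum>t \<in> periods N. ?h y t g)"
            using L y g unfolding eq by blast
          ultimately show ?thesis
            unfolding elig[OF True] by (intro divide_nonneg_pos)
        qed simp
      next
        case False
        have "0 \<le> ?h y t g" if t: "t \<in> periods N" for t
        proof -
          \<comment> \<open>Deviating in one period only is feasible because \<open>g\<close> is
            ineligible: no eligible group changes its flow.\<close>
          let ?P = "\<lambda>t' g'. t' = t \<and> g' = g"
          have "splice_flow ?P y y' \<in> cbcp_flows N \<tau> B"
            using splice_flow_in_cbcp_flows[OF y y', of ?P "\<lambda>_. False"] False by auto
          then have "0 \<le> (\<Sum>t' \<in> periods N. ?h (splice_flow ?P y y') t' g)"
            using L g unfolding eq by blast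
          then show ?thesis using t by (simp add: period_gap_splice_flow)
        qed
        then show ?thesis using vot_pos[OF g] by (intro sum_nonneg divide_nonneg_pos) auto
      qed
      then show "0 \<le> program_slope N \<tau> (lane_flow N y') y' y"
        unfolding program_slope_eq_sum_period_gap by (subst sum.swap) (rule sum_nonneg)
    qed
  next
    assume R: "\<forall>y \<in> cbcp_flows N \<tau> B. 0 \<le> program_slope N \<tau> (lane_flow N y') y' y"
    show "cbcp_equilibrium N \<tau> B y'"
      unfolding eq
    proof (intro ballI)
      fix g y assume g: "g \<in> groups N" and y: "y \<in> cbcp_flows N \<tau> B"
      \<comment> \<open>Only \<open>g\<close> deviates, in the periods selected by \<open>P\<close>,
        so all other gaps vanish. Eligible groups must deviate in all periods at once; for an
        ineligible group \<open>P\<close> can select a single period.\<close>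
      have R': "0 \<le> (\<Sum>t \<in> periods N. if P t then ?h y t g / vot N g t else 0)"
        if P: "\<And>t. g \<in> eligible N \<Longrightarrow> P t" for P
      proof -
        let ?P = "\<lambda>t' g'. g' = g \<and> P t'"
        have "splice_flow ?P y y' \<in> cbcp_flows N \<tau> B"
          using splice_flow_in_cbcp_flows[OF y y', of ?P "\<lambda>g'. g' = g"] P by auto
        then have "0 \<le> (\<Sum>t \<in> periods N. \<Sum>g' \<in> groups N. ?h (splice_flow ?P y y') t g' / vot N g' t)"
          using R program_slope_eq_sum_period_gap by metis
        also have "\<dots> = (\<Sum>t \<in> periods N. \<Sum>g' \<in> groups N.
            if g' = g then if P t then ?h y t g / vot N g t else 0 else 0)"
          by (intro sum.cong refl) (simp add: period_gap_splice_flow)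
        also have "\<dots> = (\<Sum>t \<in> periods N. if P t then ?h y t g / vot N g t else 0)"
          using finite_groups g by simp
        finally show ?thesis .
      qed
      show "0 \<le> (\<Sum>t \<in> periods N. ?h y t g)"
      proof (cases "g \<in> eligible N")
        case True
        show ?thesis
        proof (cases "periods N = {}")
          case False
          then have "0 < vot N g 1" using vot_pos[OF g, of 1] by simp
          then show ?thesis
            using R'[of "\<lambda>_. True"]
            unfolding if_True elig[OF True] zero_le_divide_iff by auto
        qed simp
      next
        case False
        show ?thesis
        proof (rule sum_nonneg)
          fix t assume t: "t \<in> periods N"
          have "0 \<le> ?h y t g / vot N g t"
            using R'[of "\<lambda>t'. t' = t"] False t by simp
          then show "0 \<le> ?h y t g"
            using vot_pos[OF g t] by (simp add: zero_le_divide_iff)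
        qed
      qed
    qed
  qed
qed

end

theorem proposition4p4:
  fixes N :: "('v, 'e, 'g) network"
    and \<tau> :: "'e \<times> nat \<Rightarrow> real" and B :: "'g \<Rightarrow> real" and ystar :: "('e, 'g) flow"
  assumes "cbcp_network N"
    and "\<tau> \<in> edges N \<times> periods N \<rightarrow> {0..}"
    and "B \<in> eligible N \<rightarrow> {0..}"
    and "\<And>g t t'. g \<in> eligible N \<Longrightarrow> t \<in> periods N \<Longrightarrow> t' \<in> periods N \<Longrightarrow>
           vot N g t = vot N g t'"
    and "ystar \<in> cbcp_flows N \<tau> B"
  shows "cbcp_equilibrium N \<tau> B ystar \<longleftrightarrow>
    is_arg_min (program_objective N \<tau>) (\<lambda>z. z \<in> program_feasible N \<tau> B)
      (ystar, lane_flow N ystar)"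
proof -
  interpret cbcp_network N by fact
  show ?thesis
    using cbcp_equilibrium_iff_program_slope_nonneg[OF assms(4,5)]
      program_slope_nonneg_iff_minimal[OF assms(5)] is_arg_min_program_iff[OF assms(5)]
    by (simp only:)
qed

end
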